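(* Let $\overline{\mathcal{X}}$ be a partition of $\mathcal{X}$ and let $\mathbf{f}=\{f_n\}_{n=1}^\infty$ be a sequence of functions $f_n:\mathcal{X}^n\times\mathcal{Y}^n\to\mathcal{Z}_n$ such that $f_n$ is $\overline{\mathcal{X}}$-informative for every $n$. Then for every general source $(\mathbf{X},\mathbf{Y})$ that is smooth with respect to $\mathbf{Y}$, $$R(\mathbf{X}|\mathbf{Y}|\mathbf{f})=R_{\mathsf{SW}}([\mathbf{X}]_{\overline{\mathcal{X}}}|\mathbf{Y}).$$
   Context: Finite alphabets $\mathcal{X}=\{0,\dots,|\mathcal{X}|-1\}$, $\mathcal{Y}=\{0,\dots,|\mathcal{Y}|-1\}$. A general source $(\mathbf{X},\mathbf{Y})=\{(X^n,Y^n)\}_{n\ge1}$ is an arbitrary sequence of joint distributions $P_{X^nY^n}$ on $\mathcal{X}^n\times\mathcal{Y}^n$ (no stationarity, memorylessness or ergodicity is assumed). For a sequence $\mathbf{f}=\{f_n\}$, $f_n:\mathcal{X}^n\times\mathcal{Y}^n\to\mathcal{Z}_n$, a code $\Phi_n=(\varphi_n,\psi_n)$ consists of an encoder $\varphi_n:\mathcal{X}^n\to\mathcal{M}_n$ and a decoder $\psi_n:\mathcal{M}_n\times\mathcal{Y}^n\to\mathcal{Z}_n$, with error probability $\Pr(\psi_n(\varphi_n(X^n),Y^n)\ne f_n(X^n,Y^n))$. A rate $R$ is achievable if there are codes with error probability $\to0$ and $\limsup_n \frac1n\log|\mathcal{M}_n|\le R$; $R(\mathbf{X}|\mathbf{Y}|\mathbf{f})$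 is the infimum of achievable rates. The Slepian–Wolf rate $R_{\mathsf{SW}}(\mathbf{X}|\mathbf{Y})$ is $R(\mathbf{X}|\mathbf{Y}|\mathbf{f}^{\mathsf{id}})$ for $f_n^{\mathsf{id}}(\mathbf{x},\mathbf{y})=\mathbf{x}$ (for a source with first component on another finite alphabet the same definitions apply). Logs are base 2. A source is smooth with respect to $\mathbf{Y}$ if there is a constant $0<q<1$ independent of $n$ with $P_{X^nY^n}(\mathbf{x},\hat{\mathbf{y}})\ge qP_{X^nY^n}(\mathbf{x},\mathbf{y})$ for all $n$, $\mathbf{x}\in\mathcal{X}^n$ and $\mathbf{y},\hat{\mathbf{y}}\in\mathcal{Y}^n$ at Hamming distance $1$. For a partition $\overline{\mathcal{X}}$ of $\mathcal{X}$ and $x\in\mathcal{X}$, $[x]_{\overline{\mathcal{X}}}$ is the cell containing $x$; $[\mathbf{x}]_{\overline{\mathcal{X}}}=([x_1]_{\overline{\mathcal{X}}},\dots,[x_n]_{\overline{\mathcal{X}}})$. The source $([\mathbf{X}]_{\overline{\mathcal{X}}},\mathbf{Y})=\{([X^n]_{\overline{\mathcal{X}}},Y^n)\}$ has $P_{[X^n]Y^n}(\overline{\mathbf{x}},\mathbf{y})=\sum_{\mathbf{x}:[\mathbf{x}]_{\overline{\mathcal{X}}}=\overline{\mathbf{x}}}P_{X^nY^n}(\mathbf{x},\mathbf{y})$, on alphabet $\overline{\mathcal{X}}\times\mathcal{Y}$. For $a\in\mathcal{X}$, $\mathbf{x}\in\mathcal{X}^n$, $i\in[1:n]$, $a\mathbf{x}^{(-i)}$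 is $\mathbf{x}$ with its $i$th entry replaced by $a$; similarly $b\mathbf{y}^{(-i)}$. For a permutation $\sigma$ of $[1:n]$, $\sigma(\mathbf{x})$ is the sequence with $i$th entry $x_{\sigma(i)}$. $f_n$ is $\overline{\mathcal{X}}$-informative if (1) for each $i\in[1:n]$ there is a map $\xi_n^{(i)}:\mathcal{Z}_n^{|\mathcal{Y}|}\to\overline{\mathcal{X}}$ with $\xi_n^{(i)}\big((f_n(a\mathbf{x}^{(-i)},b\mathbf{y}^{(-i)}):b\in\mathcal{Y})\big)=[a]_{\overline{\mathcal{X}}}$ for all $a\in\mathcal{X}$, $(\mathbf{x},\mathbf{y})\in\mathcal{X}^n\times\mathcal{Y}^n$; and (2) $f_n(\sigma(\mathbf{x}),\mathbf{y})=f_n(\mathbf{x},\mathbf{y})$ for all $(\mathbf{x},\mathbf{y})$ and all permutations $\sigma$ of $[1:n]$ with $[\sigma(\mathbf{x})]_{\overline{\mathcal{X}}}=[\mathbf{x}]_{\overline{\mathcal{X}}}$. *)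

theory Defs
  imports "HOL-Probability.Probability" "HOL-Library.Disjoint_Sets" "HOL-Combinatorics.Permutations"
begin

text \<open>Alphabets are X = {..<nx}, Y = {..<ny}; length-n sequences are lists of length n.
  A general source is a sequence of pmfs P n on pairs of sequences.\<close>

definition seqs :: "'a set \<Rightarrow> nat \<Rightarrow> 'a list set" where
  "seqs A n = {xs. length xs = n \<and> set xs \<subseteq> A}"

definition general_source :: "'a set \<Rightarrow> nat \<Rightarrow> (nat \<Rightarrow> ('a list \<times> nat list) pmf) \<Rightarrow> bool" where
  "general_source A ny P \<longleftrightarrow> (\<forall>n\<ge>1. set_pmf (P n) \<subseteq> seqs A n \<times> seqs {..<ny} n)"

definition hamming_dist :: "'a list \<Rightarrow> 'a list \<Rightarrow> nat" where
  "hamming_dist xs ys = card {i. i < length xs \<and> xs ! i \<noteq> ys ! i}"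

definition smooth_wrt_Y :: "nat \<Rightarrow> nat \<Rightarrow> (nat \<Rightarrow> (nat list \<times> nat list) pmf) \<Rightarrow> bool" where
  "smooth_wrt_Y nx ny P \<longleftrightarrow> (\<exists>q::real. 0 < q \<and> q < 1 \<and>
     (\<forall>n\<ge>1. \<forall>x\<in>seqs {..<nx} n. \<forall>y\<in>seqs {..<ny} n. \<forall>y'\<in>seqs {..<ny} n.
        hamming_dist y y' = 1 \<longrightarrow> pmf (P n) (x, y') \<ge> q * pmf (P n) (x, y)))"

definition achievable_rate ::
  "'a set \<Rightarrow> (nat \<Rightarrow> ('a list \<times> nat list) pmf) \<Rightarrow> (nat \<Rightarrow> 'a list \<Rightarrow> nat list \<Rightarrow> 'z) \<Rightarrow> real \<Rightarrow> bool" where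
  "achievable_rate A P f R \<longleftrightarrow>
     (\<exists>(M :: nat \<Rightarrow> nat) (enc :: nat \<Rightarrow> 'a list \<Rightarrow> nat) (dec :: nat \<Rightarrow> nat \<Rightarrow> nat list \<Rightarrow> 'z).
        (\<forall>n. enc n ` seqs A n \<subseteq> {..<M n}) \<and>
        ((\<lambda>n. measure_pmf.prob (P n) {(x, y). dec n (enc n x) y \<noteq> f n x y}) \<longlonglongrightarrow> 0) \<and>
        (\<forall>\<epsilon>>0. eventually (\<lambda>n. log 2 (real (M n)) / real n \<le> R + \<epsilon>) sequentially))"

definition opt_rate ::
  "'a set \<Rightarrow> (nat \<Rightarrow> ('a list \<times> nat list) pmf) \<Rightarrow> (nat \<Rightarrow> 'a list \<Rightarrow> nat list \<Rightarrow> 'z) \<Rightarrow> real" where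
  "opt_rate A P f = Inf {R. achievable_rate A P f R}"

definition R_SW :: "'a set \<Rightarrow> (nat \<Rightarrow> ('a list \<times> nat list) pmf) \<Rightarrow> real" where
  "R_SW A P = opt_rate A P (\<lambda>n x y. x)"

definition cell :: "nat set set \<Rightarrow> nat \<Rightarrow> nat set" where
  "cell Pt a = (THE c. c \<in> Pt \<and> a \<in> c)"

definition quotient_source :: "nat set set \<Rightarrow> (nat \<Rightarrow> (nat list \<times> nat list) pmf)
    \<Rightarrow> nat \<Rightarrow> (nat set list \<times> nat list) pmf" where
  "quotient_source Pt P n = map_pmf (\<lambda>(x, y). (map (cell Pt) x, y)) (P n)"

definition informative :: "nat \<Rightarrow> nat \<Rightarrow> nat set set \<Rightarrow> nat \<Rightarrow> (nat list \<Rightarrow> nat list \<Rightarrow> 'z) \<Rightarrow> bool" where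
  "informative nx ny Pt n fn \<longleftrightarrow>
     (\<forall>i<n. \<exists>\<xi> :: 'z list \<Rightarrow> nat set.
        \<forall>a<nx. \<forall>x\<in>seqs {..<nx} n. \<forall>y\<in>seqs {..<ny} n.
          \<xi> (map (\<lambda>b. fn (x[i := a]) (y[i := b])) [0..<ny]) = cell Pt a) \<and>
     (\<forall>x\<in>seqs {..<nx} n. \<forall>y\<in>seqs {..<ny} n. \<forall>\<sigma>. \<sigma> permutes {..<n} \<longrightarrow>
        map (cell Pt) (map (\<lambda>i. x ! \<sigma> i) [0..<n]) = map (cell Pt) x \<longrightarrow>
        fn (map (\<lambda>i. x ! \<sigma> i) [0..<n]) y = fn x y)"

end

theory Submission
  imports Defs "HOL-Real_Asymp.Real_Asymp"
begin

text \<open>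
  Both problems have the same achievable rates. A Slepian--Wolf code for \<open>[X]\<close> becomes a code
  for \<open>f\<close> by also sending the type of \<open>x\<close>, which takes only polynomially many
  values: \<open>[x]\<close> and the type determine \<open>x\<close> up to a permutation that leaves \<open>f\<close> unchanged.

  Conversely, from a codeword of an \<open>f\<close>-code and \<open>y\<close> one guesses \<open>[x\<^sub>i]\<close> for every \<open>i\<close> by
  running the decoder with the \<open>i\<close>th letter of \<open>y\<close> replaced by every \<open>b\<close>. By smoothness these
  perturbed runs fail with probability at most a constant times the original error, so by Markov's
  inequality \<open>[x]\<close> lies with high probability in a Hamming ball of relative radius \<open>o(1)\<close> around
  the guess. An encoder that sees only \<open>[x]\<close> cannot produce the codeword, which depends on \<open>x\<close>, so
  the decoder forms the union of these balls over all \<open>M\<^sub>n\<close> codewords. This is a list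
  of \<open>M\<^sub>n\<close> times a subexponential number of candidates, determined by \<open>y\<close> alone, and binning with
  slightly more bins singles out \<open>[x]\<close>.
\<close>

lemma seqs_altdef: "seqs A n = {xs. set xs \<subseteq> A \<and> length xs = n}"
  by (auto simp: seqs_def)

lemma finite_seqs: "finite A \<Longrightarrow> finite (seqs A n)"
  by (simp add: seqs_altdef finite_lists_length_eq)

lemma seqs_Suc: "seqs A (Suc n) = (\<lambda>(a, xs). a # xs) ` (A \<times> seqs A n)"
  by (auto simp: seqs_def image_iff length_Suc_conv)

lemma list_update_in_seqs: "xs \<in> seqs A n \<Longrightarrow> a \<in> A \<Longrightarrow> xs[i := a] \<in> seqs A n"
  using set_update_subset_insert[of xs i a] by (auto simp: seqs_def)

text \<open>Indicator form, so that union bounds and Markov's inequality become pointwise estimates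
  of summands.\<close>

lemma prob_eq_sum_of_bool:
  assumes "finite S" "set_pmf p \<subseteq> S"
  shows "measure_pmf.prob p A = (\<Sum>s\<in>S. pmf p s * of_bool (s \<in> A))"
proof -
  have "measure_pmf.prob p A = measure_pmf.prob p (S \<inter> A)"
    using assms(2) by (intro measure_pmf.finite_measure_eq_AE) (auto simp: AE_measure_pmf_iff)
  also have "\<dots> = (\<Sum>s\<in>S \<inter> A. pmf p s)"
    using assms(1) by (simp add: measure_measure_pmf_finite)
  also have "\<dots> = (\<Sum>s\<in>S. pmf p s * of_bool (s \<in> A))"
    using assms(1) by (simp add: of_bool_def if_distrib sum.inter_restrict cong: if_cong)
  finally show ?thesis .
qed

text \<open>Meant for the map that overwrites one letter of \<open>y\<close>, which merges at most
  \<open>c = ny\<close> sequences.\<close>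

lemma sum_compose_le_card_fibres:
  fixes g :: "'b \<Rightarrow> real"
  assumes "finite A" "finite B" "T ` A \<subseteq> B"
    and "\<And>z. z \<in> B \<Longrightarrow> card {a\<in>A. T a = z} \<le> c" and "\<And>z. z \<in> B \<Longrightarrow> 0 \<le> g z"
  shows "(\<Sum>a\<in>A. g (T a)) \<le> real c * (\<Sum>z\<in>B. g z)"
proof -
  have "(\<Sum>a\<in>A. g (T a)) = (\<Sum>z\<in>B. \<Sum>a | a \<in> A \<and> T a = z. g (T a))"
    using assms(1-3) by (rule sum.group[symmetric])
  also have "\<dots> = (\<Sum>z\<in>B. real (card {a\<in>A. T a = z}) * g z)"
    by (intro sum.cong refl) simp
  also have "\<dots> \<le> (\<Sum>z\<in>B. real c * g z)"
    using assms by (intro sum_mono mult_right_mono) auto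
  finally show ?thesis by (simp add: sum_distrib_left)
qed

section \<open>Hamming distance and the size of Hamming balls\<close>

lemma hamming_dist_Cons:
  "hamming_dist (a # u) (b # v) = of_bool (a \<noteq> b) + hamming_dist u v"
proof -
  have "{i. i < length (a # u) \<and> (a # u) ! i \<noteq> (b # v) ! i} =
        (if a \<noteq> b then {0} else {}) \<union> Suc ` {i. i < length u \<and> u ! i \<noteq> v ! i}" (is "?L = ?R")
  proof (rule set_eqI)
    show "i \<in> ?L \<longleftrightarrow> i \<in> ?R" for i by (cases i) auto
  qed
  moreover have "card ?R = of_bool (a \<noteq> b) + card {i. i < length u \<and> u ! i \<noteq> v ! i}"
    by (subst card_Un_disjoint) (auto simp: card_image)
  ultimately show ?thesis by (simp add: hamming_dist_def)
qed

lemma hamming_dist_eq_sum: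
  "hamming_dist u v = (\<Sum>i<length u. of_bool (u ! i \<noteq> v ! i))"
  by (simp add: hamming_dist_def of_bool_def sum.If_cases lessThan_def Collect_conj_eq)

text \<open>The sum factorises over positions: an agreeing letter contributes 1, every other letter
  \<open>t\<close>. The bound also covers letters of \<open>w\<close> outside \<open>A\<close>,
  which estimates built from decoder outputs may contain.\<close>

lemma sum_power_hamming_dist_le:
  fixes t :: real
  assumes "finite A" "0 \<le> t" "length w = n"
  shows "(\<Sum>v\<in>seqs A n. t ^ hamming_dist v w) \<le> (1 + real (card A) * t) ^ n"
  using assms(3)
proof (induction n arbitrary: w)
  case 0
  have "seqs A 0 = {[]}" by (auto simp: seqs_def)
  then show ?case by (simp add: hamming_dist_def)
next
  case (Suc n)
  then obtain b w' where w: "w = b # w'" "length w' = n" by (cases w) auto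
  have letter: "(\<Sum>a\<in>A. t ^ of_bool (a \<noteq> b)) \<le> 1 + real (card A) * t"
  proof -
    have "(\<Sum>a\<in>A. t ^ of_bool (a \<noteq> b)) \<le> (\<Sum>a\<in>A. of_bool (a = b) + t)"
      using assms by (intro sum_mono) auto
    also have "\<dots> = (\<Sum>a\<in>A. of_bool (a = b)) + real (card A) * t"
      by (simp add: sum.distrib)
    also have "(\<Sum>a\<in>A. of_bool (a = b) :: real) \<le> 1"
      using assms by (simp add: of_bool_def)
    finally show ?thesis by simp
  qed
  have "(\<Sum>v\<in>seqs A (Suc n). t ^ hamming_dist v w)
      = (\<Sum>(a, v)\<in>A \<times> seqs A n. t ^ of_bool (a \<noteq> b) * t ^ hamming_dist v w')"
    unfolding seqs_Suc w
    by (subst sum.reindex) (auto simp: inj_on_def hamming_dist_Cons power_add intro!: sum.cong)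
  also have "\<dots> = (\<Sum>a\<in>A. t ^ of_bool (a \<noteq> b)) * (\<Sum>v\<in>seqs A n. t ^ hamming_dist v w')"
    by (simp add: sum.cartesian_product[symmetric] sum_product)
  also have "\<dots> \<le> (1 + real (card A) * t) * (1 + real (card A) * t) ^ n"
    using letter Suc.IH[OF w(2)] assms by (intro mult_mono sum_nonneg) auto
  finally show ?case by simp
qed

text \<open>Chernoff-style bound: as \<open>t < 1\<close>, each \<open>v\<close> in the ball has
  weight \<open>t powr (hamming_dist v w - r)\<close> at least 1, and the total weight of all
  sequences is bounded by the generating function.\<close>

lemma card_hamming_ball_le:
  fixes t r :: real
  assumes "finite A" "0 < t" "t < 1" "length w = n"
  shows "real (card {v \<in> seqs A n. real (hamming_dist v w) \<le> r})
    \<le> t powr (- r) * (1 + real (card A) * t) ^ n"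
proof -
  have fin: "finite (seqs A n)" using assms finite_seqs by blast
  have "real (card {v \<in> seqs A n. real (hamming_dist v w) \<le> r})
      = (\<Sum>v | v \<in> seqs A n \<and> real (hamming_dist v w) \<le> r. 1)" by simp
  also have "\<dots> \<le> (\<Sum>v | v \<in> seqs A n \<and> real (hamming_dist v w) \<le> r.
                        t powr (- r) * t ^ hamming_dist v w)"
  proof (rule sum_mono)
    fix v assume v: "v \<in> {v \<in> seqs A n. real (hamming_dist v w) \<le> r}"
    have "t powr 0 \<le> t powr (- r + real (hamming_dist v w))"
      using v assms by (intro powr_mono') auto
    then show "1 \<le> t powr (- r) * t ^ hamming_dist v w"
      using assms by (simp only: powr_add powr_realpow) simp
  qed
  also have "\<dots> \<le> (\<Sum>v\<in>seqs A n. t powr (- r) * t ^ hamming_dist v w)"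
    using fin assms by (intro sum_mono2) auto
  also have "\<dots> \<le> t powr (- r) * (1 + real (card A) * t) ^ n"
    using sum_power_hamming_dist_le[of A t w n] assms
    by (simp add: sum_distrib_left[symmetric] mult_left_mono)
  finally show ?thesis .
qed

section \<open>Binning\<close>

text \<open>A deterministic replacement for random binning: give each new vertex the colour that
  creates the least conflict weight, which is at most the average over all colours.\<close>

lemma ex_coloring_few_conflicts:
  fixes w :: "'a \<Rightarrow> 'a \<Rightarrow> real"
  assumes "finite U" "0 < N"
  shows "\<exists>h. h ` U \<subseteq> {..<N} \<and>
    real N * (\<Sum>u\<in>U. \<Sum>v\<in>U - {u}. w u v * of_bool (h u = h v)) \<le> (\<Sum>u\<in>U. \<Sum>v\<in>U - {u}. w u v)"
  using assms(1)
proof (induction U rule: finite_induct)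
  case empty
  then show ?case by simp
next
  case (insert a U)
  then obtain h where h: "h ` U \<subseteq> {..<N}"
    "real N * (\<Sum>u\<in>U. \<Sum>v\<in>U - {u}. w u v * of_bool (h u = h v)) \<le> (\<Sum>u\<in>U. \<Sum>v\<in>U - {u}. w u v)"
    by blast
  \<comment> \<open>Weight of the conflicts created by giving \<open>a\<close> the colour
    \<open>c\<close>. Every \<open>u\<close> has exactly one colour below \<open>N\<close>, so these
    weights add up to the whole weight between \<open>a\<close> and \<open>U\<close>.\<close>
  define g where "g c = (\<Sum>u\<in>U. (w a u + w u a) * of_bool (h u = c))" for c
  have split: "(\<Sum>u\<in>insert a U. \<Sum>v\<in>insert a U - {u}. F u v) =
      (\<Sum>u\<in>U. F a u + F u a) + (\<Sum>u\<in>U. \<Sum>v\<in>U - {u}. F u v)" for F :: "'a \<Rightarrow> 'a \<Rightarrow> real"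
  proof -
    have "(\<Sum>u\<in>insert a U. \<Sum>v\<in>insert a U - {u}. F u v) =
        (\<Sum>v\<in>U. F a v) + (\<Sum>u\<in>U. \<Sum>v\<in>insert a U - {u}. F u v)"
      using insert.hyps by (simp add: insert_Diff_if)
    also have "(\<Sum>u\<in>U. \<Sum>v\<in>insert a U - {u}. F u v) = (\<Sum>u\<in>U. F u a + (\<Sum>v\<in>U - {u}. F u v))"
      using insert.hyps by (intro sum.cong refl) (auto simp: insert_Diff_if)
    finally show ?thesis by (simp add: sum.distrib)
  qed
  have total: "(\<Sum>c<N. g c) = (\<Sum>u\<in>U. w a u + w u a)"
  proof -
    have "(\<Sum>c<N. g c) = (\<Sum>u\<in>U. \<Sum>c<N. (w a u + w u a) * of_bool (h u = c))"
      unfolding g_def by (rule sum.swap)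
    also have "\<dots> = (\<Sum>u\<in>U. w a u + w u a)"
      using h(1) by (intro sum.cong refl) (auto simp: of_bool_def if_distrib cong: if_cong)
    finally show ?thesis .
  qed
  obtain c where c: "c < N" "real N * g c \<le> (\<Sum>u\<in>U. w a u + w u a)"
  proof -
    have "\<exists>c<N. real N * g c \<le> (\<Sum>c<N. g c)"
    proof (rule ccontr)
      assume neg: "\<not> ?thesis"
      \<comment> \<open>The inner sum is constant in the outer index, so both sides equal
        \<open>N\<close> times the total of \<open>g\<close>, although each summand is assumed
        strictly smaller.\<close>
      have "(\<Sum>c<N. \<Sum>c<N. g c) < (\<Sum>c<N. real N * g c)"
        using neg assms(2) by (intro sum_strict_mono) auto
      then show False by (simp add: sum_distrib_left)
    qed
    then show ?thesis using that total by auto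
  qed
  define h' where "h' = h(a := c)"
  have h'_U: "h' u = h u" if "u \<in> U" for u
    using that insert.hyps by (auto simp: h'_def)
  have "(\<Sum>u\<in>U. w a u * of_bool (h' a = h' u) + w u a * of_bool (h' u = h' a)) = g c"
    unfolding g_def h'_def using insert.hyps
    by (intro sum.cong refl) (auto simp: of_bool_def algebra_simps)
  moreover have "(\<Sum>u\<in>U. \<Sum>v\<in>U - {u}. w u v * of_bool (h' u = h' v))
               = (\<Sum>u\<in>U. \<Sum>v\<in>U - {u}. w u v * of_bool (h u = h v))"
    using h'_U by (intro sum.cong refl) simp_all
  ultimately have "real N * (\<Sum>u\<in>insert a U. \<Sum>v\<in>insert a U - {u}. w u v * of_bool (h' u = h' v))
      \<le> (\<Sum>u\<in>insert a U. \<Sum>v\<in>insert a U - {u}. w u v)"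
    unfolding split using c(2) h(2) by (simp add: distrib_left)
  moreover have "h' ` insert a U \<subseteq> {..<N}"
    using h(1) c(1) by (auto simp: h'_def)
  ultimately show ?case by blast
qed

text \<open>The decoder looks in \<open>L y\<close> for a candidate in the received bin. It errs
  only if \<open>u\<close> is not a candidate or a rival candidate shares its bin. Lists have at
  most \<open>B\<close> members, so the total conflict weight is at most \<open>B\<close>, and the
  colouring cuts it by the factor \<open>N\<close>.\<close>

lemma ex_binning_of_list_decoding:
  fixes p :: "('u \<times> 'y) pmf" and L :: "'y \<Rightarrow> 'u set"
  assumes "finite U" "finite V" "set_pmf p \<subseteq> U \<times> V" "0 < N"
    and L: "\<And>y. y \<in> V \<Longrightarrow> L y \<subseteq> U" "\<And>y. y \<in> V \<Longrightarrow> real (card (L y)) \<le> B"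
  shows "\<exists>(h :: 'u \<Rightarrow> nat) dec. h ` U \<subseteq> {..<N} \<and>
    measure_pmf.prob p {(u, y). dec (h u) y \<noteq> u}
      \<le> measure_pmf.prob p {(u, y). u \<notin> L y} + B / real N"
proof -
  \<comment> \<open>Probability that \<open>u\<close> occurs together with a \<open>y\<close> whose
    list contains \<open>v\<close>, that is, that \<open>v\<close> can be a rival of
    \<open>u\<close>.\<close>
  define w where "w u v = (\<Sum>y\<in>V. pmf p (u, y) * of_bool (v \<in> L y))" for u v
  obtain h where h: "h ` U \<subseteq> {..<N}"
    "real N * (\<Sum>u\<in>U. \<Sum>v\<in>U - {u}. w u v * of_bool (h u = h v)) \<le> (\<Sum>u\<in>U. \<Sum>v\<in>U - {u}. w u v)"
    using ex_coloring_few_conflicts[OF assms(1,4), of w] by blast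
  define dec where "dec m y = (SOME v. v \<in> L y \<and> h v = m)" for m y
  define E where "E = {(u, y). \<exists>v\<in>L y - {u}. h u = h v}"
  have sum1: "(\<Sum>s\<in>U \<times> V. pmf p s) = 1"
    using assms by (intro sum_pmf_eq_1) auto
  have err: "{(u, y). dec (h u) y \<noteq> u} \<subseteq> {(u, y). u \<notin> L y} \<union> E"
  proof -
    have "dec (h u) y = u" if u: "u \<in> L y" "(u, y) \<notin> E" for u y
      unfolding dec_def
    proof (rule some_equality)
      fix v assume "v \<in> L y \<and> h v = h u"
      then have "v \<in> L y" "h u = h v" by auto
      then show "v = u" using u(2) unfolding E_def by blast
    qed (use u in auto)
    then show ?thesis by auto
  qed
  have "measure_pmf.prob p E \<le> (\<Sum>u\<in>U. \<Sum>v\<in>U - {u}. w u v * of_bool (h u = h v))"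
  proof -
    have "measure_pmf.prob p E = (\<Sum>s\<in>U \<times> V. pmf p s * of_bool (s \<in> E))"
      using assms by (intro prob_eq_sum_of_bool) auto
    also have "\<dots> = (\<Sum>u\<in>U. \<Sum>y\<in>V. pmf p (u, y) * of_bool ((u, y) \<in> E))"
      by (simp add: sum.cartesian_product)
    \<comment> \<open>Union bound: a collision is counted by the number of rivals in the same
      bin.\<close>
    also have "\<dots> \<le> (\<Sum>u\<in>U. \<Sum>y\<in>V. pmf p (u, y) *
        (\<Sum>v\<in>U - {u}. of_bool (v \<in> L y) * of_bool (h u = h v)))"
    proof (intro sum_mono mult_left_mono)
      fix u y assume "u \<in> U" "y \<in> V"
      show "of_bool ((u, y) \<in> E) \<le> (\<Sum>v\<in>U - {u}. of_bool (v \<in> L y) * of_bool (h u = h v) :: real)"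
      proof (cases "(u, y) \<in> E")
        case True
        then obtain v where v: "v \<in> L y - {u}" "h u = h v" by (auto simp: E_def)
        then have "v \<in> U - {u}" using L(1) \<open>y \<in> V\<close> by auto
        then have "of_bool (v \<in> L y) * of_bool (h u = h v)
            \<le> (\<Sum>v\<in>U - {u}. of_bool (v \<in> L y) * of_bool (h u = h v) :: real)"
          using assms(1) by (intro member_le_sum) auto
        then show ?thesis using v by simp
      qed (simp add: sum_nonneg)
    qed simp
    also have "\<dots> = (\<Sum>u\<in>U. \<Sum>v\<in>U - {u}. w u v * of_bool (h u = h v))"
    proof (intro sum.cong refl)
      fix u
      have "(\<Sum>y\<in>V. pmf p (u, y) * (\<Sum>v\<in>U - {u}. of_bool (v \<in> L y) * of_bool (h u = h v)))
          = (\<Sum>y\<in>V. \<Sum>v\<in>U - {u}. pmf p (u, y) * (of_bool (v \<in> L y) * of_bool (h u = h v)))"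
        by (simp only: sum_distrib_left)
      also have "\<dots> = (\<Sum>v\<in>U - {u}. w u v * of_bool (h u = h v))"
        unfolding w_def by (subst sum.swap) (simp only: sum_distrib_right mult.assoc)
      finally show "(\<Sum>y\<in>V. pmf p (u, y) * (\<Sum>v\<in>U - {u}. of_bool (v \<in> L y) * of_bool (h u = h v)))
          = (\<Sum>v\<in>U - {u}. w u v * of_bool (h u = h v))" .
    qed
    finally show ?thesis .
  qed
  then have "real N * measure_pmf.prob p E \<le> (\<Sum>u\<in>U. \<Sum>v\<in>U - {u}. w u v)"
    using h(2) mult_left_mono[of _ _ "real N"] by (meson of_nat_0_le_iff order_trans)
  \<comment> \<open>With the diagonal added, the sum over \<open>v\<close> is exactly
    \<open>card (L y)\<close>.\<close>
  also have "\<dots> \<le> (\<Sum>u\<in>U. \<Sum>v\<in>U. w u v)"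
    using assms(1) by (intro sum_mono sum_mono2) (auto simp: w_def intro!: sum_nonneg)
  also have "\<dots> = (\<Sum>u\<in>U. \<Sum>y\<in>V. \<Sum>v\<in>U. pmf p (u, y) * of_bool (v \<in> L y))"
    unfolding w_def by (intro sum.cong refl sum.swap)
  also have "\<dots> = (\<Sum>u\<in>U. \<Sum>y\<in>V. pmf p (u, y) * real (card (L y)))"
  proof (intro sum.cong refl)
    fix u y assume "y \<in> V"
    then have "(\<Sum>v\<in>U. of_bool (v \<in> L y) :: real) = real (card (L y))"
      using L(1)[of y] assms(1) by (simp add: of_bool_def sum.If_cases Int_absorb1)
    then show "(\<Sum>v\<in>U. pmf p (u, y) * of_bool (v \<in> L y)) = pmf p (u, y) * real (card (L y))"
      by (simp only: sum_distrib_left[symmetric])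
  qed
  also have "\<dots> \<le> (\<Sum>u\<in>U. \<Sum>y\<in>V. pmf p (u, y) * B)"
    using L(2) by (intro sum_mono mult_left_mono) auto
  also have "\<dots> = (\<Sum>s\<in>U \<times> V. pmf p s) * B"
    by (simp add: sum.cartesian_product sum_distrib_right)
  finally have "measure_pmf.prob p E \<le> B / real N"
    using assms(4) by (simp add: sum1 field_simps)
  moreover have "measure_pmf.prob p {(u, y). dec (h u) y \<noteq> u}
      \<le> measure_pmf.prob p {(u, y). u \<notin> L y} + measure_pmf.prob p E"
    using measure_pmf.finite_measure_mono[OF err, of p]
      measure_Un_le[of "{(u, y). u \<notin> L y}" "measure_pmf p" E] by simp
  ultimately show ?thesis using h(1) by (intro exI[of _ h] exI[of _ dec]) auto
qed

section \<open>Cells of a partition and code rates\<close>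

lemma cell_in_partition:
  assumes "partition_on A Pt" "a \<in> A"
  shows "cell Pt a \<in> Pt"
proof -
  obtain c where c: "c \<in> Pt" "a \<in> c"
    using assms by (auto simp: partition_on_def)
  then have "cell Pt a = c"
    unfolding cell_def using partition_onD2[OF assms(1)]
    by (intro the_equality) (auto dest: disjointD)
  then show ?thesis using c by simp
qed

lemma map_cell_in_seqs:
  assumes "partition_on A Pt" "x \<in> seqs A n"
  shows "map (cell Pt) x \<in> seqs Pt n"
  using assms cell_in_partition[OF assms(1)] by (auto simp: seqs_def)

lemma seqs_nonempty: "A \<noteq> {} \<Longrightarrow> seqs A n \<noteq> {}"
proof -
  assume "A \<noteq> {}"
  then obtain a where "a \<in> A" by blast
  then have "replicate n a \<in> seqs A n" by (auto simp: seqs_def)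
  then show ?thesis by blast
qed

text \<open>Positive sizes make \<open>log 2\<close> additive on products of code sizes.\<close>

lemma code_size_pos:
  assumes "enc ` seqs A n \<subseteq> {..<M :: nat}" "A \<noteq> {}"
  shows "0 < M"
  using assms seqs_nonempty[of A n] by auto

text \<open>Absorbs the overhead of a converted code: \<open>K\<close> bounds the number of types in
  one direction, and in the other it is the ball bound times the surplus of bins.\<close>

lemma rate_mult_subexponential:
  fixes M K :: "nat \<Rightarrow> nat" and R \<epsilon> :: real
  assumes "\<And>n. 0 < M n" "\<And>n. 0 < K n"
    and "(\<lambda>n. log 2 (real (K n)) / real n) \<longlonglongrightarrow> 0"
    and "\<forall>\<epsilon>>0. eventually (\<lambda>n. log 2 (real (M n)) / real n \<le> R + \<epsilon>) sequentially" and "0 < \<epsilon>"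
  shows "eventually (\<lambda>n. log 2 (real (M n * K n)) / real n \<le> R + \<epsilon>) sequentially"
proof -
  have "eventually (\<lambda>n. log 2 (real (M n)) / real n \<le> R + \<epsilon> / 2) sequentially"
    using assms(4,5) by simp
  moreover have "eventually (\<lambda>n. log 2 (real (K n)) / real n < \<epsilon> / 2) sequentially"
    using assms(3,5) by (intro order_tendstoD) auto
  ultimately show ?thesis
  proof eventually_elim
    case (elim n)
    have "log 2 (real (M n * K n)) / real n
        = log 2 (real (M n)) / real n + log 2 (real (K n)) / real n"
      using assms(1,2)[of n] by (simp add: log_mult add_divide_distrib)
    then show ?case using elim by linarith
  qed
qed

section \<open>Types, and codes for the function from codes for the cells\<close>

text \<open>The multiset of a sequence is its type. It is determined by \<open>k\<close> letter
  counts, each between 0 and \<open>n\<close>.\<close>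

lemma card_mset_image_seqs_le:
  "card (mset ` seqs {..<k} n) \<le> Suc n ^ k"
proof -
  let ?c = "\<lambda>T. map (count T) [0..<k]"
  have "inj_on ?c (mset ` seqs {..<k} n)"
  proof (rule inj_onI)
    fix S T assume ST: "S \<in> mset ` seqs {..<k} n" "T \<in> mset ` seqs {..<k} n" "?c S = ?c T"
    show "S = T"
    proof (rule multiset_eqI)
      fix a
      show "count S a = count T a"
      proof (cases "a < k")
        case True
        then show ?thesis using ST(3) by (auto simp: map_eq_conv)
      next
        case False
        then have "a \<notin># S" "a \<notin># T" using ST(1,2) by (auto simp: seqs_def)
        then show ?thesis by (metis not_in_iff)
      qed
    qed
  qed
  moreover have "?c ` mset ` seqs {..<k} n \<subseteq> seqs {..n} k"
  proof (clarsimp simp: seqs_def)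
    fix xs :: "nat list" and a
    show "count (mset xs) a \<le> length xs" by (metis count_le_size size_mset)
  qed
  ultimately have "card (mset ` seqs {..<k} n) \<le> card (seqs {..n} k)"
    by (intro card_inj_on_le finite_seqs) auto
  then show ?thesis by (simp add: seqs_altdef card_lists_length_eq)
qed

text \<open>Equal multisets provide a permutation from \<open>x\<close> to \<open>x'\<close>; since
  it preserves cells, the second condition of informativeness applies.\<close>

lemma informative_same_type:
  assumes "informative nx ny Pt n fn" "x \<in> seqs {..<nx} n" "y \<in> seqs {..<ny} n"
    and "mset x' = mset x" "map (cell Pt) x' = map (cell Pt) x"
  shows "fn x' y = fn x y"
proof -
  obtain \<sigma> where \<sigma>: "\<sigma> permutes {..<length x}" "permute_list \<sigma> x = x'"
    using mset_eq_permutation[OF assms(4)] by blast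
  have n: "length x = n" using assms by (simp add: seqs_def)
  then have x': "x' = map (\<lambda>i. x ! \<sigma> i) [0..<n]" using \<sigma>(2) by (simp add: permute_list_def)
  show ?thesis
    using assms(1,2,3,5) \<sigma>(1) n unfolding informative_def x' by blast
qed

text \<open>Informativeness and support guard only the error bound, so that a code of the right size
  is also available at blocklength 0, where neither is known.\<close>

lemma function_code_of_quotient_code:
  fixes f :: "nat list \<Rightarrow> nat list \<Rightarrow> 'z" and M :: nat
  assumes "partition_on {..<nx} Pt" "enc ` seqs Pt n \<subseteq> {..<M}"
  shows "\<exists>enc' dec'. enc' ` seqs {..<nx} n \<subseteq> {..<M * Suc n ^ nx} \<and>
    (informative nx ny Pt n f \<longrightarrow> set_pmf p \<subseteq> seqs {..<nx} n \<times> seqs {..<ny} n \<longrightarrow>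
      measure_pmf.prob p {(x, y). dec' (enc' x) y \<noteq> f x y} \<le>
      measure_pmf.prob p {(x, y). dec (enc (map (cell Pt) x)) y \<noteq> map (cell Pt) x})"
proof -
  define T where "T = Suc n ^ nx"
  have "finite (mset ` seqs {..<nx} n)" by (simp add: finite_seqs)
  then obtain type where type: "type ` mset ` seqs {..<nx} n \<subseteq> {..<T}"
      "inj_on type (mset ` seqs {..<nx} n)"
    using card_mset_image_seqs_le[of nx n] card_le_inj[of "mset ` seqs {..<nx} n" "{..<T}"]
    unfolding T_def by auto
  have T: "0 < T" by (simp add: T_def)
  \<comment> \<open>Mixed radix: type numbers lie below \<open>T\<close>, so \<open>div T\<close>
    recovers the codeword of the cells and \<open>mod T\<close> the type.\<close>
  define enc' where "enc' x = enc (map (cell Pt) x) * T + type (mset x)" for x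
  \<comment> \<open>Any sequence with the decoded cells and type can stand in for the source
    sequence, since an informative \<open>f\<close> does not tell them apart.\<close>
  define dec' where "dec' m y = f (SOME x. x \<in> seqs {..<nx} n \<and>
      map (cell Pt) x = dec (m div T) y \<and> type (mset x) = m mod T) y" for m y
  have range: "enc' x < M * T" if "x \<in> seqs {..<nx} n" for x
  proof -
    have "enc (map (cell Pt) x) < M"
      using assms(2) map_cell_in_seqs[OF assms(1) that] by auto
    then have "Suc (enc (map (cell Pt) x)) * T \<le> M * T" by (intro mult_right_mono) auto
    moreover have "type (mset x) < T" using type(1) that by auto
    ultimately show ?thesis by (simp add: enc'_def)
  qed
  have correct: "dec' (enc' x) y = f x y"
    if "informative nx ny Pt n f" "x \<in> seqs {..<nx} n" "y \<in> seqs {..<ny} n"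
      "dec (enc (map (cell Pt) x)) y = map (cell Pt) x" for x y
  proof -
    have less: "type (mset x) < T" using type(1) that by auto
    define Q where "Q x' \<longleftrightarrow> x' \<in> seqs {..<nx} n \<and>
      map (cell Pt) x' = dec (enc' x div T) y \<and> type (mset x') = enc' x mod T" for x'
    have "Q x" using that less T by (simp add: Q_def enc'_def)
    then have Q: "Q (SOME x'. Q x')" by (rule someI)
    define x' where "x' = (SOME x'. Q x')"
    have "x' \<in> seqs {..<nx} n" "map (cell Pt) x' = map (cell Pt) x" "type (mset x') = type (mset x)"
      using Q that less T by (simp_all add: Q_def enc'_def x'_def)
    moreover from this have "mset x' = mset x" using type(2) that by (auto dest: inj_onD)
    ultimately have "f x' y = f x y" using informative_same_type that by metis
    then show ?thesis by (simp add: dec'_def x'_def Q_def)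
  qed
  have "measure_pmf.prob p {(x, y). dec' (enc' x) y \<noteq> f x y} \<le>
      measure_pmf.prob p {(x, y). dec (enc (map (cell Pt) x)) y \<noteq> map (cell Pt) x}"
    if "informative nx ny Pt n f" "set_pmf p \<subseteq> seqs {..<nx} n \<times> seqs {..<ny} n"
    using that correct
    by (intro measure_pmf.finite_measure_mono_AE) (auto simp: AE_measure_pmf_iff)
  then show ?thesis using range unfolding T_def by (intro exI[of _ enc'] exI[of _ dec']) auto
qed

lemma prob_quotient_source:
  "measure_pmf.prob (quotient_source Pt P n) {(u, y). Q u y}
    = measure_pmf.prob (P n) {(x, y). Q (map (cell Pt) x) y}"
  by (auto simp: quotient_source_def intro!: arg_cong[where f = "measure_pmf.prob (P n)"])

lemma achievable_function_of_quotient: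
  fixes f :: "nat \<Rightarrow> nat list \<Rightarrow> nat list \<Rightarrow> 'z"
  assumes "0 < nx" "partition_on {..<nx} Pt" "\<forall>n\<ge>1. informative nx ny Pt n (f n)"
    and "general_source {..<nx} ny P"
    and "achievable_rate Pt (quotient_source Pt P) (\<lambda>n x y. x) R"
  shows "achievable_rate {..<nx} P f R"
proof -
  obtain M enc dec where code: "\<And>n. enc n ` seqs Pt n \<subseteq> {..<M n}"
    "(\<lambda>n. measure_pmf.prob (quotient_source Pt P n) {(u, y). dec n (enc n u) y \<noteq> u}) \<longlonglongrightarrow> 0"
    "\<forall>\<epsilon>>0. eventually (\<lambda>n. log 2 (real (M n)) / real n \<le> R + \<epsilon>) sequentially"
    using assms(5) unfolding achievable_rate_def by blast
  \<comment> \<open>Bundled for a single \<open>n\<close>, so that codes can be chosen for all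
    \<open>n\<close> at once. The size is controlled at every \<open>n\<close>, the error from
    \<open>n = 1\<close> on, where the source is constrained.\<close>
  define good where "good n enc' dec' \<longleftrightarrow> enc' ` seqs {..<nx} n \<subseteq> {..<M n * Suc n ^ nx} \<and>
    (n \<ge> 1 \<longrightarrow> measure_pmf.prob (P n) {(x, y). dec' (enc' x) y \<noteq> f n x y} \<le>
      measure_pmf.prob (quotient_source Pt P n) {(u, y). dec n (enc n u) y \<noteq> u})" for n enc' dec'
  have "\<exists>enc' dec'. good n enc' dec'" for n
    using function_code_of_quotient_code[OF assms(2) code(1), of n ny "f n" "P n" "dec n"] assms(3,4)
    unfolding good_def prob_quotient_source general_source_def by blast
  then obtain enc' dec' where "\<And>n. good n (enc' n) (dec' n)" by metis
  then have code': "\<And>n. enc' n ` seqs {..<nx} n \<subseteq> {..<M n * Suc n ^ nx}"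
    "\<And>n. n \<ge> 1 \<Longrightarrow> measure_pmf.prob (P n) {(x, y). dec' n (enc' n x) y \<noteq> f n x y} \<le>
      measure_pmf.prob (quotient_source Pt P n) {(u, y). dec n (enc n u) y \<noteq> u}"
    unfolding good_def by blast+
  have "Pt \<noteq> {}" using assms(1,2) by (auto simp: partition_on_def)
  then have M: "0 < M n" for n using code(1) code_size_pos by blast
  have "(\<lambda>n. measure_pmf.prob (P n) {(x, y). dec' n (enc' n x) y \<noteq> f n x y}) \<longlonglongrightarrow> 0"
    using code'(2) by (intro tendsto_sandwich[OF _ _ tendsto_const code(2)]
        eventually_sequentiallyI[of 1]) auto
  moreover have "(\<lambda>n. log 2 (real (Suc n ^ nx)) / real n) \<longlonglongrightarrow> 0"
  proof -
    have "(\<lambda>n. real nx * (log 2 (real n + 1) / real n)) \<longlonglongrightarrow> real nx * 0"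
      by (intro tendsto_mult_left) real_asymp
    then show ?thesis by (simp add: log_nat_power add.commute)
  qed
  then have "\<forall>\<epsilon>>0. eventually (\<lambda>n. log 2 (real (M n * Suc n ^ nx)) / real n \<le> R + \<epsilon>) sequentially"
    using M code(3) by (intro allI impI rate_mult_subexponential) auto
  ultimately show ?thesis
    unfolding achievable_rate_def using code'(1)
    by (intro exI[of _ "\<lambda>n. M n * Suc n ^ nx"] exI[of _ enc'] exI[of _ dec']) auto
qed

section \<open>Changing one letter of the side information under smoothness\<close>

lemma hamming_dist_list_update:
  assumes "i < length y"
  shows "hamming_dist y (y[i := b]) = of_bool (y ! i \<noteq> b)"
proof -
  have "{j. j < length y \<and> y ! j \<noteq> y[i := b] ! j} = (if y ! i \<noteq> b then {i} else {})"
    using assms by (auto simp: nth_list_update)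
  then show ?thesis by (simp add: hamming_dist_def)
qed

text \<open>One blocklength of a smooth source; \<open>q\<close> is a parameter so that all
  blocklengths can share it.\<close>

locale smooth_pmf =
  fixes nx ny n :: nat and p :: "(nat list \<times> nat list) pmf" and q :: real
  assumes supp: "set_pmf p \<subseteq> seqs {..<nx} n \<times> seqs {..<ny} n"
    and q: "0 < q" "q < 1"
    and smooth: "\<lbrakk>x \<in> seqs {..<nx} n; y \<in> seqs {..<ny} n; y' \<in> seqs {..<ny} n; hamming_dist y y' = 1\<rbrakk>
      \<Longrightarrow> q * pmf p (x, y) \<le> pmf p (x, y')"
begin

lemma pmf_list_update_ge:
  assumes "x \<in> seqs {..<nx} n" "y \<in> seqs {..<ny} n" "i < n" "b < ny"
  shows "q * pmf p (x, y) \<le> pmf p (x, y[i := b])"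
proof (cases "y ! i = b")
  case True
  then have "y[i := b] = y" by auto
  then show ?thesis using q mult_right_mono[of q 1 "pmf p (x, y)"] by simp
next
  case False
  then have "hamming_dist y (y[i := b]) = 1"
    using assms by (subst hamming_dist_list_update) (auto simp: seqs_def)
  then show ?thesis using assms by (intro smooth list_update_in_seqs) auto
qed

text \<open>Smoothness bounds the mass of \<open>(x, y)\<close> by \<open>1 / q\<close> times that
  of \<open>(x, y[i := b])\<close>. The update is not injective, but the overwritten letter
  determines the preimage, so each pair is hit at most \<open>ny\<close> times.\<close>

lemma prob_list_update_le:
  assumes "i < n" "b < ny"
  shows "measure_pmf.prob p {(x, y). (x, y[i := b]) \<in> E} \<le> real ny / q * measure_pmf.prob p E"
proof -
  let ?X = "seqs {..<nx} n" and ?Y = "seqs {..<ny} n"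
  have fin: "finite (?X \<times> ?Y)" by (simp add: finite_seqs)
  have "q * measure_pmf.prob p {(x, y). (x, y[i := b]) \<in> E}
      = (\<Sum>(x, y)\<in>?X \<times> ?Y. q * pmf p (x, y) * of_bool ((x, y[i := b]) \<in> E))"
    unfolding prob_eq_sum_of_bool[OF fin supp] sum_distrib_left
    by (intro sum.cong refl) (auto simp: mult.assoc)
  also have "\<dots> \<le> (\<Sum>(x, y)\<in>?X \<times> ?Y. pmf p (x, y[i := b]) * of_bool ((x, y[i := b]) \<in> E))"
    using assms by (intro sum_mono) (auto intro!: mult_right_mono pmf_list_update_ge)
  also have "\<dots> = (\<Sum>s\<in>?X \<times> ?Y. (\<lambda>s. pmf p s * of_bool (s \<in> E)) ((\<lambda>(x, y). (x, y[i := b])) s))"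
    by (simp add: case_prod_beta)
  also have "\<dots> \<le> real ny * (\<Sum>s\<in>?X \<times> ?Y. pmf p s * of_bool (s \<in> E))"
  proof (rule sum_compose_le_card_fibres[OF fin fin])
    show "(\<lambda>(x, y). (x, y[i := b])) ` (?X \<times> ?Y) \<subseteq> ?X \<times> ?Y"
      using assms by (auto intro: list_update_in_seqs)
    fix z assume "z \<in> ?X \<times> ?Y"
    obtain x' y' where z: "z = (x', y')" by fastforce
    have "{s \<in> ?X \<times> ?Y. (\<lambda>(x, y). (x, y[i := b])) s = z} \<subseteq> (\<lambda>c. (x', y'[i := c])) ` {..<ny}"
    proof
      fix s assume "s \<in> {s \<in> ?X \<times> ?Y. (\<lambda>(x, y). (x, y[i := b])) s = z}"
      then obtain x y where xy: "s = (x, y)" "x \<in> ?X" "y \<in> ?Y" "(x, y[i := b]) = z" by auto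
      then have "y = y'[i := y ! i]" "x = x'" by (auto simp: z)
      moreover have "length y = n" "set y \<subseteq> {..<ny}" using xy by (auto simp: seqs_def)
      then have "y ! i < ny" using assms(1) nth_mem[of i y] by blast
      ultimately show "s \<in> (\<lambda>c. (x', y'[i := c])) ` {..<ny}" unfolding xy(1) by blast
    qed
    from surj_card_le[OF finite_lessThan this]
    show "card {s \<in> ?X \<times> ?Y. (\<lambda>(x, y). (x, y[i := b])) s = z} \<le> ny"
      unfolding card_lessThan .
  qed auto
  also have "\<dots> = real ny * measure_pmf.prob p E"
    using fin supp by (simp add: prob_eq_sum_of_bool)
  finally show ?thesis using q by (simp add: field_simps)
qed

text \<open>A wrong letter requires a failure in one of \<open>ny\<close> perturbed runs, each of
  probability at most \<open>real ny / q\<close> times the original error. This gives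
  \<open>real (ny\<^sup>2) / q\<close> per letter, and Markov's inequality handles the number of
  wrong letters. \<open>w\<close> sees only a message and \<open>y\<close>, so it can be evaluated
  for every message.\<close>

lemma ex_letterwise_estimate:
  fixes f :: "nat list \<Rightarrow> nat list \<Rightarrow> 'z" and enc :: "nat list \<Rightarrow> nat"
  assumes "informative nx ny Pt n f" "0 < n"
  shows "\<exists>w. (\<forall>m y. length (w m y) = n) \<and>
    (\<forall>\<delta>>0. measure_pmf.prob p
        {(x, y). real n * \<delta> < real (hamming_dist (map (cell Pt) x) (w (enc x) y))}
      \<le> real (ny\<^sup>2) / q * measure_pmf.prob p {(x, y). dec (enc x) y \<noteq> f x y} / \<delta>)"
proof -
  let ?X = "seqs {..<nx} n" and ?Y = "seqs {..<ny} n"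
  obtain \<xi> where \<xi>: "\<And>i a x y. \<lbrakk>i < n; a < nx; x \<in> ?X; y \<in> ?Y\<rbrakk> \<Longrightarrow>
      \<xi> i (map (\<lambda>b. f (x[i := a]) (y[i := b])) [0..<ny]) = cell Pt a"
    using assms(1) unfolding informative_def by metis
  \<comment> \<open>\<open>\<xi> i\<close> expects values of \<open>f\<close> as the
    \<open>i\<close>th letter of \<open>y\<close> varies; decoder outputs for the fixed message
    \<open>m\<close> take their place.\<close>
  define w where "w m y = map (\<lambda>i. \<xi> i (map (\<lambda>b. dec m (y[i := b])) [0..<ny])) [0..<n]" for m y
  define E where "E = {(x, y). dec (enc x) y \<noteq> f x y}"
  let ?d = "\<lambda>(x, y). hamming_dist (map (cell Pt) x) (w (enc x) y)"
  have fin: "finite (?X \<times> ?Y)" by (simp add: finite_seqs)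
  have letter: "of_bool (map (cell Pt) x ! i \<noteq> w (enc x) y ! i)
      \<le> (\<Sum>b<ny. of_bool ((x, y[i := b]) \<in> E) :: real)"
    if "x \<in> ?X" "y \<in> ?Y" "i < n" for x y i
  proof (cases "\<exists>b<ny. (x, y[i := b]) \<in> E")
    case True
    then obtain b where b: "b < ny" "(x, y[i := b]) \<in> E" by blast
    then have "of_bool ((x, y[i := b]) \<in> E) \<le> (\<Sum>b<ny. of_bool ((x, y[i := b]) \<in> E) :: real)"
      by (intro member_le_sum) auto
    with b show ?thesis by simp
  next
    case False
    then have est: "map (\<lambda>b. dec (enc x) (y[i := b])) [0..<ny] = map (\<lambda>b. f x (y[i := b])) [0..<ny]"
      by (auto simp: E_def)
    have "length x = n" "set x \<subseteq> {..<nx}" using that by (auto simp: seqs_def)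
    moreover from this have "x ! i < nx" using that(3) nth_mem[of i x] by blast
    moreover have "w (enc x) y ! i = \<xi> i (map (\<lambda>b. f x (y[i := b])) [0..<ny])"
      unfolding est[symmetric] using that by (simp add: w_def)
    \<comment> \<open>With \<open>a = x ! i\<close> the update of \<open>x\<close> changes nothing,
      so all the runs concern the encoded \<open>x\<close> itself.\<close>
    ultimately have "w (enc x) y ! i = map (cell Pt) x ! i"
      using \<xi>[of i "x ! i" x y] that by simp
    then show ?thesis by (simp add: sum_nonneg)
  qed
  have dist: "real (?d (x, y)) \<le> (\<Sum>i<n. \<Sum>b<ny. of_bool ((x, y[i := b]) \<in> E))"
    if "x \<in> ?X" "y \<in> ?Y" for x y
  proof -
    have "length x = n" using that by (simp add: seqs_def)
    then have "real (?d (x, y)) = (\<Sum>i<n. of_bool (map (cell Pt) x ! i \<noteq> w (enc x) y ! i))"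
      by (simp add: hamming_dist_eq_sum)
    also have "\<dots> \<le> (\<Sum>i<n. \<Sum>b<ny. of_bool ((x, y[i := b]) \<in> E))"
      using that by (intro sum_mono letter) auto
    finally show ?thesis .
  qed
  have mean: "(\<Sum>s\<in>?X \<times> ?Y. pmf p s * real (?d s)) \<le> real n * (real (ny\<^sup>2) / q * measure_pmf.prob p E)"
  proof -
    have "(\<Sum>s\<in>?X \<times> ?Y. pmf p s * real (?d s))
        \<le> (\<Sum>s\<in>?X \<times> ?Y. pmf p s * (\<Sum>i<n. \<Sum>b<ny. of_bool (s \<in> {(x, y). (x, y[i := b]) \<in> E})))"
      using dist by (intro sum_mono mult_left_mono) auto
    also have "\<dots> = (\<Sum>i<n. \<Sum>b<ny. \<Sum>s\<in>?X \<times> ?Y. pmf p s * of_bool (s \<in> {(x, y). (x, y[i := b]) \<in> E}))"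
      by (simp only: sum_distrib_left sum.swap[of _ _ "?X \<times> ?Y"])
    also have "\<dots> = (\<Sum>i<n. \<Sum>b<ny. measure_pmf.prob p {(x, y). (x, y[i := b]) \<in> E})"
      using fin supp by (simp only: prob_eq_sum_of_bool)
    also have "\<dots> \<le> (\<Sum>i<n. \<Sum>b<ny. real ny / q * measure_pmf.prob p E)"
      by (intro sum_mono prob_list_update_le) auto
    also have "\<dots> = real n * (real (ny\<^sup>2) / q * measure_pmf.prob p E)"
      by (simp add: power2_eq_square)
    finally show ?thesis .
  qed
  have "measure_pmf.prob p {s. real n * \<delta> < real (?d s)}
      \<le> real (ny\<^sup>2) / q * measure_pmf.prob p E / \<delta>" if "0 < \<delta>" for \<delta>
  proof -
    have "(real n * \<delta>) * measure_pmf.prob p {s. real n * \<delta> < real (?d s)}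
        = (\<Sum>s\<in>?X \<times> ?Y. pmf p s * ((real n * \<delta>) * of_bool (real n * \<delta> < real (?d s))))"
      unfolding prob_eq_sum_of_bool[OF fin supp] sum_distrib_left
      by (intro sum.cong refl) (simp only: mem_Collect_eq mult.left_commute)
    \<comment> \<open>Markov's inequality, pointwise: \<open>real n * \<delta>\<close> times the
      indicator is at most the distance.\<close>
    also have "\<dots> \<le> (\<Sum>s\<in>?X \<times> ?Y. pmf p s * real (?d s))"
      by (intro sum_mono mult_left_mono) auto
    also note mean
    finally have "real n * (\<delta> * measure_pmf.prob p {s. real n * \<delta> < real (?d s)})
        \<le> real n * (real (ny\<^sup>2) / q * measure_pmf.prob p E)" by (simp only: mult.assoc)
    then have "\<delta> * measure_pmf.prob p {s. real n * \<delta> < real (?d s)}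
        \<le> real (ny\<^sup>2) / q * measure_pmf.prob p E"
      using assms(2) by (simp only: mult_le_cancel_left_pos of_nat_0_less_iff)
    then show ?thesis unfolding pos_le_divide_eq[OF that] by (simp only: mult.commute)
  qed
  moreover have "{s. real n * \<delta> < real (?d s)} =
      {(x, y). real n * \<delta> < real (hamming_dist (map (cell Pt) x) (w (enc x) y))}" for \<delta>
    by auto
  moreover have "length (w m y) = n" for m y by (simp add: w_def)
  ultimately show ?thesis unfolding E_def by (intro exI[of _ w]) simp
qed

end

section \<open>Growth of the Hamming ball bound\<close>

text \<open>Hamming balls of radius \<open>n\<delta>\<close>: the choice \<open>t = \<delta>\<close> in the generating-function bound makes the
  rate vanish as \<open>\<delta> \<rightarrow> 0\<close>.\<close>

definition ball_bound :: "nat \<Rightarrow> nat \<Rightarrow> real \<Rightarrow> nat" where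
  "ball_bound k n \<delta> = nat \<lceil>\<delta> powr (- (real n * \<delta>)) * (1 + real k * \<delta>) ^ n\<rceil>"

lemma ball_bound_pos: "0 < \<delta> \<Longrightarrow> 0 < ball_bound k n \<delta>"
proof -
  assume "0 < \<delta>"
  then have "0 < \<delta> powr (- (real n * \<delta>)) * (1 + real k * \<delta>) ^ n"
    by (intro mult_pos_pos zero_less_power) (auto simp: add_pos_nonneg)
  then show ?thesis by (simp add: ball_bound_def)
qed

lemma ball_bound_rate_le:
  assumes "0 < \<delta>" "\<delta> < 1" "0 < n"
  shows "log 2 (real (ball_bound k n \<delta>)) / real n
    \<le> 1 / real n + \<delta> * (- log 2 \<delta>) + log 2 (1 + real k * \<delta>)"
proof -
  define z where "z = \<delta> powr (- (real n * \<delta>)) * (1 + real k * \<delta>) ^ n"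
  have one: "1 \<le> 1 + real k * \<delta>" using assms by simp
  have "\<delta> powr 0 \<le> \<delta> powr (- (real n * \<delta>))" using assms by (intro powr_mono') auto
  then have "1 \<le> \<delta> powr (- (real n * \<delta>))" using assms by simp
  then have "1 * 1 \<le> z" unfolding z_def using one by (intro mult_mono one_le_power) auto
  then have z: "1 \<le> z" by simp
  \<comment> \<open>Rounding up adds at most 1, which a factor 2 absorbs because
    \<open>1 \<le> z\<close>; this is the source of the term \<open>1 / real n\<close>.\<close>
  have "real (ball_bound k n \<delta>) \<le> z + 1"
    using z by (simp add: ball_bound_def z_def[symmetric])
  then have "log 2 (real (ball_bound k n \<delta>)) \<le> log 2 (2 * z)"
    using z ball_bound_pos[OF assms(1), of k n] by (subst log_le_cancel_iff) auto
  also have "\<dots> = 1 + log 2 z" using z by (simp add: log_mult)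
  also have "log 2 z = log 2 (\<delta> powr (- (real n * \<delta>))) + log 2 ((1 + real k * \<delta>) ^ n)"
    unfolding z_def using assms one by (intro log_mult_pos zero_less_power) (auto intro: less_le_trans[OF zero_less_one])
  also have "\<dots> = real n * (\<delta> * (- log 2 \<delta>) + log 2 (1 + real k * \<delta>))"
    using assms one by (simp add: log_powr log_nat_power algebra_simps)
  finally show ?thesis using assms(3) by (simp add: field_simps)
qed

text \<open>\<open>Suc n\<close> is the surplus of bins over candidates that brings the collision
  probability down to \<open>1 / (real n + 1)\<close>.\<close>

lemma ball_bound_subexponential:
  assumes "\<And>n. 0 < \<delta> n" "\<delta> \<longlonglongrightarrow> 0"
  shows "(\<lambda>n. log 2 (real (Suc n * ball_bound k n (\<delta> n))) / real n) \<longlonglongrightarrow> 0"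
proof -
  have pos: "0 < ball_bound k n (\<delta> n)" for n using assms(1) ball_bound_pos by blast
  \<comment> \<open>The limit of \<open>x * log 2 x\<close> at 0 is taken from the right, where the
    positive \<open>\<delta> n\<close> lie.\<close>
  have right: "filterlim \<delta> (at_right 0) sequentially"
    using assms by (intro tendsto_imp_filterlim_at_right) auto
  have "((\<lambda>x. x * (- log 2 x)) \<longlongrightarrow> 0) (at_right (0::real))" by real_asymp
  then have 1: "(\<lambda>n. \<delta> n * (- log 2 (\<delta> n))) \<longlonglongrightarrow> 0"
    using right by (rule filterlim_compose)
  have 2: "(\<lambda>n. log 2 (1 + real k * \<delta> n)) \<longlonglongrightarrow> log 2 (1 + real k * 0)"
    using assms by (intro tendsto_intros) auto
  have "(\<lambda>n. 1 / real n + \<delta> n * (- log 2 (\<delta> n)) + log 2 (1 + real k * \<delta> n)) \<longlonglongrightarrow> 0 + 0 + 0"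
    using 1 2 by (intro tendsto_add lim_1_over_n) auto
  then have lim: "(\<lambda>n. 1 / real n + \<delta> n * (- log 2 (\<delta> n)) + log 2 (1 + real k * \<delta> n)) \<longlonglongrightarrow> 0"
    by (simp only: add_0)
  have upper: "eventually (\<lambda>n. log 2 (real (ball_bound k n (\<delta> n))) / real n
      \<le> 1 / real n + \<delta> n * (- log 2 (\<delta> n)) + log 2 (1 + real k * \<delta> n)) sequentially"
    using order_tendstoD(2)[OF assms(2) zero_less_one] eventually_gt_at_top[of 0]
    by eventually_elim (rule ball_bound_rate_le[OF assms(1)])
  have lower: "0 \<le> log 2 (real (ball_bound k n (\<delta> n))) / real n" for n
    using pos[of n] by (intro divide_nonneg_nonneg) auto
  have ball: "(\<lambda>n. log 2 (real (ball_bound k n (\<delta> n))) / real n) \<longlonglongrightarrow> 0"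
    by (rule tendsto_sandwich[OF always_eventually[OF allI[OF lower]] upper tendsto_const lim])
  have "(\<lambda>n. log 2 (real n + 1) / real n) \<longlonglongrightarrow> 0" by real_asymp
  from tendsto_add[OF this ball]
  have "(\<lambda>n. log 2 (real n + 1) / real n + log 2 (real (ball_bound k n (\<delta> n))) / real n) \<longlonglongrightarrow> 0"
    by simp
  moreover have "log 2 (real (Suc n * ball_bound k n (\<delta> n))) / real n
      = log 2 (real n + 1) / real n + log 2 (real (ball_bound k n (\<delta> n))) / real n" for n
    unfolding of_nat_mult using pos[of n] by (subst log_mult_pos) (auto simp: add_divide_distrib add.commute)
  ultimately show ?thesis by (simp only:)
qed

section \<open>Codes for the cells from codes for the function\<close>

text \<open>The new encoder only bins cell sequences. The first error term bounds the probability
  that the cells are missing from the list of \<open>y\<close>, the second that of a bin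
  collision.\<close>

lemma (in smooth_pmf) quotient_code_of_function_code:
  fixes f :: "nat list \<Rightarrow> nat list \<Rightarrow> 'z" and M :: nat and Pt :: "nat set set"
  defines "p' \<equiv> map_pmf (\<lambda>(x, y). (map (cell Pt) x, y)) p"
  assumes "partition_on {..<nx} Pt" "informative nx ny Pt n f" "0 < n" "0 < M"
    and "enc ` seqs {..<nx} n \<subseteq> {..<M}" "0 < \<delta>" "\<delta> < 1"
  shows "\<exists>enc' dec'. enc' ` seqs Pt n \<subseteq> {..<M * (Suc n * ball_bound (card Pt) n \<delta>)} \<and>
    measure_pmf.prob p' {(u, y). dec' (enc' u) y \<noteq> u}
      \<le> real (ny\<^sup>2) / q * measure_pmf.prob p {(x, y). dec (enc x) y \<noteq> f x y} / \<delta> + 1 / (real n + 1)"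
proof -
  let ?D = "ball_bound (card Pt) n \<delta>" and ?C = "real (ny\<^sup>2) / q"
  have finPt: "finite Pt" using assms(2) finite_elements by blast
  obtain w where w: "\<And>m y. length (w m y) = n"
    "measure_pmf.prob p {(x, y). real n * \<delta> < real (hamming_dist (map (cell Pt) x) (w (enc x) y))}
      \<le> ?C * measure_pmf.prob p {(x, y). dec (enc x) y \<noteq> f x y} / \<delta>"
    using ex_letterwise_estimate[OF assms(3,4), of enc dec] assms(7) by blast
  define ball where "ball m y = {v \<in> seqs Pt n. real (hamming_dist v (w m y)) \<le> real n * \<delta>}" for m y
  define L where "L y = (\<Union>m<M. ball m y)" for y
  have "real (card (L y)) \<le> real (M * ?D)" for y
  proof -
    have "card (ball m y) \<le> ?D" for m
    proof -
      have "real (card (ball m y)) \<le> \<delta> powr (- (real n * \<delta>)) * (1 + real (card Pt) * \<delta>) ^ n"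
        unfolding ball_def using finPt assms(7,8) w(1) by (intro card_hamming_ball_le) auto
      then show ?thesis unfolding ball_bound_def by linarith
    qed
    then have "(\<Sum>m<M. card (ball m y)) \<le> (\<Sum>m<M. ?D)" by (intro sum_mono)
    then have "card (L y) \<le> M * ?D"
      unfolding L_def using card_UN_le[of "{..<M}" "\<lambda>m. ball m y"] by simp
    then show ?thesis by (simp only: of_nat_le_iff)
  qed
  moreover have "L y \<subseteq> seqs Pt n" for y by (auto simp: L_def ball_def)
  moreover have "set_pmf p' \<subseteq> seqs Pt n \<times> seqs {..<ny} n"
    using supp map_cell_in_seqs[OF assms(2)] by (auto simp: p'_def)
  moreover have pos: "0 < M * (Suc n * ?D)" using assms(5,7) ball_bound_pos by simp
  ultimately obtain h d where hd: "h ` seqs Pt n \<subseteq> {..<M * (Suc n * ?D)}"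
    "measure_pmf.prob p' {(u, y). d (h u) y \<noteq> u}
      \<le> measure_pmf.prob p' {(u, y). u \<notin> L y} + real (M * ?D) / real (M * (Suc n * ?D))"
    using ex_binning_of_list_decoding[OF finite_seqs[OF finPt] finite_seqs[OF finite_lessThan],
        of p' n ny n "M * (Suc n * ?D)" L "real (M * ?D)"] by blast
  have "measure_pmf.prob p' {(u, y). u \<notin> L y}
      = measure_pmf.prob p {(x, y). map (cell Pt) x \<notin> L y}"
    unfolding p'_def by (auto intro!: arg_cong[where f = "measure_pmf.prob p"])
  also have "\<dots> \<le> measure_pmf.prob p
      {(x, y). real n * \<delta> < real (hamming_dist (map (cell Pt) x) (w (enc x) y))}"
  proof (rule measure_pmf.finite_measure_mono_AE)
    \<comment> \<open>The message \<open>enc x\<close> is one of those forming \<open>L y\<close>,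
      so cells outside the list lie outside its ball in particular.\<close>
    have "real n * \<delta> < real (hamming_dist (map (cell Pt) x) (w (enc x) y))"
      if "x \<in> seqs {..<nx} n" "map (cell Pt) x \<notin> L y" for x y
      using that assms(6) map_cell_in_seqs[OF assms(2)]
      by (force simp: L_def ball_def not_le)
    then show "AE s in measure_pmf p. s \<in> {(x, y). map (cell Pt) x \<notin> L y} \<longrightarrow>
        s \<in> {(x, y). real n * \<delta> < real (hamming_dist (map (cell Pt) x) (w (enc x) y))}"
      using supp by (auto simp: AE_measure_pmf_iff)
  qed auto
  moreover have "real (M * ?D) / real (M * (Suc n * ?D)) = 1 / (real n + 1)"
  proof -
    have "real (M * (Suc n * ?D)) = real (M * ?D) * (real n + 1)" by (simp add: algebra_simps)
    moreover have "real (M * ?D) \<noteq> 0" using pos by auto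
    ultimately show ?thesis by (simp only: divide_divide_eq_left[symmetric] divide_self not_False_eq_True)
  qed
  ultimately have "measure_pmf.prob p' {(u, y). d (h u) y \<noteq> u}
      \<le> ?C * measure_pmf.prob p {(x, y). dec (enc x) y \<noteq> f x y} / \<delta> + 1 / (real n + 1)"
    using hd(2) w(2) by linarith
  then show ?thesis using hd(1) by blast
qed

lemma achievable_quotient_of_function:
  fixes f :: "nat \<Rightarrow> nat list \<Rightarrow> nat list \<Rightarrow> 'z"
  assumes "0 < nx" "partition_on {..<nx} Pt" "\<forall>n\<ge>1. informative nx ny Pt n (f n)"
    and "general_source {..<nx} ny P" "smooth_wrt_Y nx ny P"
    and "achievable_rate {..<nx} P f R"
  shows "achievable_rate Pt (quotient_source Pt P) (\<lambda>n x y. x) R"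
proof -
  obtain M enc dec where code: "\<And>n. enc n ` seqs {..<nx} n \<subseteq> {..<M n}"
    "(\<lambda>n. measure_pmf.prob (P n) {(x, y). dec n (enc n x) y \<noteq> f n x y}) \<longlonglongrightarrow> 0"
    "\<forall>\<epsilon>>0. eventually (\<lambda>n. log 2 (real (M n)) / real n \<le> R + \<epsilon>) sequentially"
    using assms(6) unfolding achievable_rate_def by blast
  obtain q where q: "0 < q" "q < 1" "\<And>n x y y'. \<lbrakk>n \<ge> 1; x \<in> seqs {..<nx} n; y \<in> seqs {..<ny} n;
      y' \<in> seqs {..<ny} n; hamming_dist y y' = 1\<rbrakk> \<Longrightarrow> q * pmf (P n) (x, y) \<le> pmf (P n) (x, y')"
    using assms(5) unfolding smooth_wrt_Y_def by blast
  have "smooth_pmf nx ny n (P n) q" if "n \<ge> 1" for n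
    using q that assms(4) by unfold_locales (auto simp: general_source_def)
  note smooth = this
  have M: "0 < M n" for n using code(1) assms(1) by (intro code_size_pos[of "enc n"]) auto
  define err where "err n = measure_pmf.prob (P n) {(x, y). dec n (enc n x) y \<noteq> f n x y}" for n
  define C where "C = real (ny\<^sup>2) / q"
  \<comment> \<open>The square root makes \<open>C * err n / \<delta> n \<le> \<delta> n\<close>, so
    error and radius vanish together. The summand \<open>1 / (real n + 1)\<close> keeps
    \<open>\<delta> n\<close> positive even when the error is 0.\<close>
  define \<delta> where "\<delta> n = sqrt (C * err n + 1 / (real n + 1))" for n
  have C: "0 \<le> C * err n" for n using q by (simp add: C_def err_def)
  have \<delta>_pos: "0 < \<delta> n" for n using C[of n] by (auto simp: \<delta>_def intro!: add_nonneg_pos)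
  have inv: "(\<lambda>n. 1 / (real n + 1)) \<longlonglongrightarrow> 0" by real_asymp
  have "\<delta> \<longlonglongrightarrow> sqrt (C * 0 + 0)"
    unfolding \<delta>_def using code(2) inv by (intro tendsto_intros) (auto simp: err_def)
  then have \<delta>_lim: "\<delta> \<longlonglongrightarrow> 0" by simp
  let ?N = "\<lambda>n. Suc n * ball_bound (card Pt) n (\<delta> n)"
  let ?err' = "\<lambda>enc' dec' n. measure_pmf.prob (quotient_source Pt P n) {(u, y). dec' (enc' u) y \<noteq> u}"
  have N: "0 < ?N n" for n using ball_bound_pos[OF \<delta>_pos] by simp
  \<comment> \<open>The error bound is asked for only when \<open>\<delta> n < 1\<close>, which
    holds for all large \<open>n\<close>.\<close>
  define good where "good n enc' dec' \<longleftrightarrow> enc' ` seqs Pt n \<subseteq> {..<M n * ?N n} \<and>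
      (n \<ge> 1 \<and> \<delta> n < 1 \<longrightarrow> ?err' enc' dec' n \<le> \<delta> n + 1 / (real n + 1))" for n enc' dec'
  have "\<exists>enc' dec'. good n enc' dec'" for n
  proof (cases "n \<ge> 1 \<and> \<delta> n < 1")
    case True
    obtain enc' dec' where *: "enc' ` seqs Pt n \<subseteq> {..<M n * ?N n}"
      "?err' enc' dec' n \<le> C * err n / \<delta> n + 1 / (real n + 1)"
      using smooth_pmf.quotient_code_of_function_code[OF smooth[of n] assms(2), of "f n" "M n" "enc n" "\<delta> n" "dec n"]
        True assms(3) M code(1) \<delta>_pos unfolding quotient_source_def C_def err_def by auto
    have "C * err n \<le> (\<delta> n)\<^sup>2" using C[of n] by (simp add: \<delta>_def)
    then have "C * err n / \<delta> n \<le> \<delta> n"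
      using \<delta>_pos[of n] by (simp add: pos_divide_le_eq power2_eq_square)
    then have "?err' enc' dec' n \<le> \<delta> n + 1 / (real n + 1)" using *(2) by linarith
    then show ?thesis unfolding good_def using *(1) by blast
  next
    case False
    \<comment> \<open>Only the size is demanded here, and a constant encoder meets it because
      \<open>M n * ?N n\<close> is positive.\<close>
    show ?thesis
      unfolding good_def using False M[of n] N[of n] by (intro exI[of _ "\<lambda>_. 0"]) auto
  qed
  then obtain enc' dec' where "\<And>n. good n (enc' n) (dec' n)" by metis
  then have code': "\<And>n. enc' n ` seqs Pt n \<subseteq> {..<M n * ?N n}"
    "\<And>n. n \<ge> 1 \<Longrightarrow> \<delta> n < 1 \<Longrightarrow> ?err' (enc' n) (dec' n) n \<le> \<delta> n + 1 / (real n + 1)"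
    unfolding good_def by blast+
  have lim: "(\<lambda>n. \<delta> n + 1 / (real n + 1)) \<longlonglongrightarrow> 0" using tendsto_add[OF \<delta>_lim inv] by simp
  have upper: "eventually (\<lambda>n. ?err' (enc' n) (dec' n) n \<le> \<delta> n + 1 / (real n + 1)) sequentially"
    using order_tendstoD(2)[OF \<delta>_lim zero_less_one] eventually_ge_at_top[of 1]
    by eventually_elim (rule code'(2))
  have "(\<lambda>n. ?err' (enc' n) (dec' n) n) \<longlonglongrightarrow> 0"
    by (rule tendsto_sandwich[OF always_eventually[OF allI[OF measure_nonneg]] upper tendsto_const lim])
  moreover have "\<forall>\<epsilon>>0. eventually (\<lambda>n. log 2 (real (M n * ?N n)) / real n \<le> R + \<epsilon>) sequentially"
    using M N code(3) ball_bound_subexponential[OF \<delta>_pos \<delta>_lim]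
    by (intro allI impI rate_mult_subexponential) auto
  ultimately show ?thesis
    unfolding achievable_rate_def using code'(1)
    by (intro exI[of _ "\<lambda>n. M n * ?N n"] exI[of _ enc'] exI[of _ dec']) auto
qed

theorem theorem1:
  fixes nx ny :: nat
    and Pt :: "nat set set"
    and f :: "nat \<Rightarrow> nat list \<Rightarrow> nat list \<Rightarrow> 'z"
    and P :: "nat \<Rightarrow> (nat list \<times> nat list) pmf"
  assumes "0 < nx" and "0 < ny"
    and "partition_on {..<nx} Pt"
    and "\<forall>n\<ge>1. informative nx ny Pt n (f n)"
    and "general_source {..<nx} ny P"
    and "smooth_wrt_Y nx ny P"
  shows "opt_rate {..<nx} P f = R_SW Pt (quotient_source Pt P)"
proof -
  have "achievable_rate {..<nx} P f R
      \<longleftrightarrow> achievable_rate Pt (quotient_source Pt P) (\<lambda>n x y. x) R" for R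
    using achievable_function_of_quotient[OF assms(1,3,4,5)]
      achievable_quotient_of_function[OF assms(1,3,4,5,6)] by blast
  then show ?thesis by (simp add: R_SW_def opt_rate_def)
qed

end
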